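(* Let $A=(a_{ij})$ be a generic $n\times n$ matrix. The collection consisting of the unacceptable monomials of degree 2 in $S$ and the $2\times2$ subpermanents of $D$ forms a Gröbner basis for $\mathrm{Ann}(\det(A))\subset S$ with respect to any diagonal ordering.
   Context: Let $\mathsf k$ be a field of characteristic zero or of characteristic $p>2$. A generic $n\times n$ matrix $A=(a_{ij})$ is one whose entries are $n^2$ distinct variables. Put $R=\mathsf k[a_{ij}]$ and $S=\mathsf k[d_{ij}]$ ($1\le i,j\le n$), and $D=(d_{ij})$. $S$ acts on $R$ by contraction: $\prod d_{ij}^{\alpha_{ij}}\circ\prod a_{ij}^{\beta_{ij}}=\prod a_{ij}^{\beta_{ij}-\alpha_{ij}}$ if $\alpha_{ij}\le\beta_{ij}$ for all $i,j$, and $0$ otherwise, extended $\mathsf k$-bilinearly. $\mathrm{Ann}(F)=\{\Phi\in S:\Phi\circ F=0\}$. The $2\times2$ subpermanents of $D$ are the polynomials $d_{ij}d_{kl}+d_{il}d_{kj}$ with $i<k$, $j<l$. A monomial in $S$ is acceptable if it is square free and has no two variables from the same row or column of $D$, and unacceptable otherwise. A monomial order on $S$ is diagonal if for every square submatrix of $D$ the leading term of the permanent (or of the determinant) of that submatrix is the product of the entries on its main diagonal. *)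

theory Defs
  imports "HOL-Analysis.Determinants" "HOL-Library.Poly_Mapping"
begin

text \<open>
  A monomial in the variables \<^typ>\<open>'v\<close> is its exponent vector, and a polynomial is a finitely
  supported coefficient function on monomials; multiplication of polynomials is the convolution
  product of \<^theory>\<open>HOL-Library.Poly_Mapping\<close>.
\<close>

type_synonym 'v monom = "'v \<Rightarrow>\<^sub>0 nat"
type_synonym ('v, 'k) mpoly = "'v monom \<Rightarrow>\<^sub>0 'k"

text \<open>
  The variables of both rings R and S are indexed by pairs (row, column), so both rings are
  represented by the same type \<^typ>\<open>('n \<times> 'n, 'k) mpoly\<close>, where the size of the matrices is the
  cardinality of the finite linearly ordered index type \<^typ>\<open>'n\<close>. The matrix \<open>generic\<close> plays the
  role of A when its entries are read in R and of D when they are read in S.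
\<close>

definition var :: "'v \<Rightarrow> ('v, 'k::comm_ring_1) mpoly" where
  "var v = Poly_Mapping.single (Poly_Mapping.single v 1) 1"

definition generic :: "('n::finite \<times> 'n, 'k::comm_ring_1) mpoly ^ 'n ^ 'n" where
  "generic = (\<chi> i j. var (i, j))"


definition contract_monom :: "'v monom \<Rightarrow> 'v monom \<Rightarrow> ('v, 'k::comm_ring_1) mpoly" where
  "contract_monom \<alpha> \<beta> =
     (if \<forall>v. Poly_Mapping.lookup \<alpha> v \<le> Poly_Mapping.lookup \<beta> v
      then Poly_Mapping.single (\<beta> - \<alpha>) 1 else 0)"

text \<open>The factor \<open>Poly_Mapping.single 0 c\<close> is the constant polynomial \<open>c\<close>.\<close>

definition contract :: "('v, 'k::comm_ring_1) mpoly \<Rightarrow> ('v, 'k) mpoly \<Rightarrow> ('v, 'k) mpoly" where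
  "contract \<Phi> F =
     (\<Sum>\<alpha>\<in>Poly_Mapping.keys \<Phi>. \<Sum>\<beta>\<in>Poly_Mapping.keys F.
        Poly_Mapping.single 0 (Poly_Mapping.lookup \<Phi> \<alpha> * Poly_Mapping.lookup F \<beta>)
          * contract_monom \<alpha> \<beta>)"

lemma contract_single:
  "contract (Poly_Mapping.single \<alpha> 1) (Poly_Mapping.single \<beta> 1) =
     (if \<forall>v. Poly_Mapping.lookup \<alpha> v \<le> Poly_Mapping.lookup \<beta> v
      then Poly_Mapping.single (\<beta> - \<alpha>) (1::'k::comm_ring_1) else 0)"
  by (cases "(1::'k) = 0") (auto simp: contract_def contract_monom_def mult_single)

definition Ann :: "('v, 'k::comm_ring_1) mpoly \<Rightarrow> ('v, 'k) mpoly set" where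
  "Ann F = {\<Phi>. contract \<Phi> F = 0}"


definition monomial_order :: "('v monom \<Rightarrow> 'v monom \<Rightarrow> bool) \<Rightarrow> bool" where
  "monomial_order le \<longleftrightarrow>
     linear_order {(s, t). le s t} \<and>
     (\<forall>t. le 0 t) \<and>
     (\<forall>s t u. le s t \<longrightarrow> le (s + u) (t + u))"

text \<open>Only meaningful for nonzero polynomials.\<close>

definition lead_monom :: "('v monom \<Rightarrow> 'v monom \<Rightarrow> bool) \<Rightarrow> ('v, 'k::comm_ring_1) mpoly \<Rightarrow> 'v monom" where
  "lead_monom le f = (THE m. m \<in> Poly_Mapping.keys f \<and> (\<forall>t\<in>Poly_Mapping.keys f. le t m))"

definition lead_term :: "('v monom \<Rightarrow> 'v monom \<Rightarrow> bool) \<Rightarrow> ('v, 'k::comm_ring_1) mpoly \<Rightarrow> ('v, 'k) mpoly" where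
  "lead_term le f = Poly_Mapping.single (lead_monom le f) (Poly_Mapping.lookup f (lead_monom le f))"

text \<open>Ideals are the submodules of the ring regarded as a module over itself.\<close>

abbreviation ideal_span :: "('v, 'k::comm_ring_1) mpoly set \<Rightarrow> ('v, 'k) mpoly set" where
  "ideal_span \<equiv> module.span (*)"

definition groebner_basis ::
    "('v monom \<Rightarrow> 'v monom \<Rightarrow> bool) \<Rightarrow> ('v, 'k::comm_ring_1) mpoly set \<Rightarrow> ('v, 'k) mpoly set \<Rightarrow> bool" where
  "groebner_basis le I G \<longleftrightarrow>
     finite G \<and> 0 \<notin> G \<and> G \<subseteq> I \<and>
     ideal_span (lead_term le ` G) = ideal_span (lead_term le ` (I - {0}))"


text \<open>
  The square submatrix of size \<open>m\<close> of the generic matrix with rows \<open>r 0 < \<dots> < r (m - 1)\<close> and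
  columns \<open>c 0 < \<dots> < c (m - 1)\<close>.
\<close>

definition sub_perm :: "nat \<Rightarrow> (nat \<Rightarrow> 'n::finite) \<Rightarrow> (nat \<Rightarrow> 'n) \<Rightarrow> ('n \<times> 'n, 'k::comm_ring_1) mpoly" where
  "sub_perm m r c = (\<Sum>\<sigma> | \<sigma> permutes {..<m}. \<Prod>i<m. generic $ r i $ c (\<sigma> i))"

definition sub_det :: "nat \<Rightarrow> (nat \<Rightarrow> 'n::finite) \<Rightarrow> (nat \<Rightarrow> 'n) \<Rightarrow> ('n \<times> 'n, 'k::comm_ring_1) mpoly" where
  "sub_det m r c =
     (\<Sum>\<sigma> | \<sigma> permutes {..<m}. of_int (sign \<sigma>) * (\<Prod>i<m. generic $ r i $ c (\<sigma> i)))"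

text \<open>
  The permanent and the determinant of a submatrix have the same monomials, and the product of
  the main diagonal has coefficient 1 in both; hence the two alternatives below are equivalent.
  The coefficient field enters only through the polynomials whose leading terms are taken, so it
  has to be passed as a type argument.
\<close>

definition diagonal_order ::
    "'k::comm_ring_1 itself \<Rightarrow>
     (('n::{finite, linorder} \<times> 'n) monom \<Rightarrow> ('n \<times> 'n) monom \<Rightarrow> bool) \<Rightarrow> bool" where
  "diagonal_order _ le \<longleftrightarrow>
     monomial_order le \<and>
     (\<forall>m r c. strict_mono_on {..<m} r \<and> strict_mono_on {..<m} c \<longrightarrow>
        (let diag = (\<Prod>i<m. generic $ r i $ c i) :: ('n \<times> 'n, 'k) mpoly
         in lead_term le (sub_perm m r c) = diag \<or> lead_term le (sub_det m r c) = diag))"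


definition monom_degree :: "'v monom \<Rightarrow> nat" where
  "monom_degree m = (\<Sum>v\<in>Poly_Mapping.keys m. Poly_Mapping.lookup m v)"

definition acceptable :: "('n \<times> 'n) monom \<Rightarrow> bool" where
  "acceptable m \<longleftrightarrow>
     (\<forall>v. Poly_Mapping.lookup m v \<le> 1) \<and>
     (\<forall>v\<in>Poly_Mapping.keys m. \<forall>w\<in>Poly_Mapping.keys m.
        v \<noteq> w \<longrightarrow> fst v \<noteq> fst w \<and> snd v \<noteq> snd w)"

definition unacceptable_quadrics :: "('n \<times> 'n, 'k::comm_ring_1) mpoly set" where
  "unacceptable_quadrics =
     {Poly_Mapping.single m 1 | m. \<not> acceptable m \<and> monom_degree m = 2}"

definition subpermanents2 :: "('n::{finite, linorder} \<times> 'n, 'k::comm_ring_1) mpoly set" where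
  "subpermanents2 =
     {generic $ i $ j * generic $ k $ l + generic $ i $ l * generic $ k $ j | i j k l.
        i < k \<and> j < l}"

end

theory Submission
  imports Defs
begin

text \<open>
  If \<open>f\<close> annihilates the determinant, then comparing coefficients of \<open>f \<circ> det A\<close> at the complement
  of a matching shows that the coefficients of \<open>f\<close> at all perfect matchings between fixed rows
  \<open>I\<close> and columns \<open>J\<close> have alternating sum 0. A monomial that is divisible by no leading
  monomial of the proposed basis is the antidiagonal matching between some \<open>I\<close> and \<open>J\<close>, and
  this is the smallest matching between \<open>I\<close> and \<open>J\<close>. If it were the leading monomial of \<open>f\<close>, it
  would be the only matching between \<open>I\<close> and \<open>J\<close> occurring in \<open>f\<close>, contradicting the vanishing sum.
\<close>

section \<open>Monomials and leading terms\<close>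

declare One_nat_def [simp del]

abbreviation unit_monom :: "'v \<Rightarrow> 'v monom" where
  "unit_monom v \<equiv> Poly_Mapping.single v 1"

lemma monom_le_imp_diff_add:
  fixes s t :: "'v monom"
  assumes "\<And>v. Poly_Mapping.lookup s v \<le> Poly_Mapping.lookup t v"
  shows "t - s + s = t"
  using assms by (intro poly_mapping_eqI) (simp add: lookup_add lookup_minus)

lemma monom_degree_unit_add [simp]: "monom_degree (unit_monom v + unit_monom w) = 2"
proof (cases "v = w")
  case True
  then have "unit_monom v + unit_monom w = Poly_Mapping.single v 2"
    by (simp flip: single_add add: numeral_2_eq_2)
  then show ?thesis by (simp add: monom_degree_def)
next
  case False
  then have "Poly_Mapping.keys (unit_monom v + unit_monom w) = {v, w}"
    by (auto simp: in_keys_iff lookup_add lookup_single when_def split: if_splits)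
  with False show ?thesis by (simp add: monom_degree_def lookup_add lookup_single)
qed

text \<open>Every exponent is bounded by the degree, so the exponent functions lie in a finite
  function space. This gives finiteness of the set of unacceptable quadrics.\<close>

lemma finite_monom_degree: "finite {m :: 'v::finite monom. monom_degree m = d}"
proof (rule finite_imageD)
  show "inj_on Poly_Mapping.lookup {m :: 'v monom. monom_degree m = d}"
    by (simp add: inj_on_def poly_mapping.lookup_inject)
  have "Poly_Mapping.lookup m v \<le> monom_degree m" for m :: "'v monom" and v
    unfolding monom_degree_def
    by (cases "v \<in> Poly_Mapping.keys m") (auto simp: in_keys_iff intro: member_le_sum)
  then have "Poly_Mapping.lookup ` {m :: 'v monom. monom_degree m = d} \<subseteq> UNIV \<rightarrow>\<^sub>E {..d}"
    by auto
  then show "finite (Poly_Mapping.lookup ` {m :: 'v monom. monom_degree m = d})"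
    by (rule finite_subset) (auto intro: finite_PiE)
qed

section \<open>Monomial orders and leading terms\<close>

lemma monomial_orderD:
  assumes "monomial_order le"
  shows "le s s" and "le s t \<Longrightarrow> le t s \<Longrightarrow> s = t" and "le s t \<Longrightarrow> le t u \<Longrightarrow> le s u"
    and "le s t \<or> le t s" and "le s t \<Longrightarrow> le (s + u) (t + u)"
proof -
  have r: "refl {(s, t). le s t}" "antisym {(s, t). le s t}" "trans {(s, t). le s t}"
    "total {(s, t). le s t}"
    and add: "\<forall>s t u. le s t \<longrightarrow> le (s + u) (t + u)"
    using assms unfolding monomial_order_def linear_order_on_def partial_order_on_def preorder_on_def
    by blast+
  show refl: "le s s" using reflD[OF r(1), of s] by simp
  show "le s t \<Longrightarrow> le t s \<Longrightarrow> s = t" using antisymD[OF r(2), of s t] by simp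
  show "le s t \<Longrightarrow> le t u \<Longrightarrow> le s u" using transD[OF r(3), of s t u] by simp
  show "le s t \<or> le t s" using r(4) refl by (cases "s = t") (auto simp: total_on_def)
  show "le s t \<Longrightarrow> le (s + u) (t + u)" using add by blast
qed

lemma monomial_order_finite_max:
  assumes le: "monomial_order le" and "finite A" "A \<noteq> {}"
  shows "\<exists>m\<in>A. \<forall>t\<in>A. le t m"
  using assms(2,3)
proof (induction A rule: finite_ne_induct)
  case (singleton x)
  then show ?case using monomial_orderD[OF le] by auto
next
  case (insert x F)
  then show ?case using monomial_orderD[OF le] by (metis insert_iff)
qed

lemma monomial_order_finite_min:
  assumes le: "monomial_order le" and "finite A" "A \<noteq> {}"
  shows "\<exists>m\<in>A. \<forall>t\<in>A. le m t"
  using assms(2,3)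
proof (induction A rule: finite_ne_induct)
  case (singleton x)
  then show ?case using monomial_orderD[OF le] by auto
next
  case (insert x F)
  then show ?case using monomial_orderD[OF le] by (metis insert_iff)
qed

lemma lead_monom_eqI:
  assumes "monomial_order le" "m \<in> Poly_Mapping.keys f" "\<And>t. t \<in> Poly_Mapping.keys f \<Longrightarrow> le t m"
  shows "lead_monom le f = m"
  unfolding lead_monom_def using assms monomial_orderD(2)[OF assms(1)] by blast

lemma lead_monom_max:
  assumes le: "monomial_order le" and "f \<noteq> 0"
  shows "lead_monom le f \<in> Poly_Mapping.keys f"
    and "t \<in> Poly_Mapping.keys f \<Longrightarrow> le t (lead_monom le f)"
proof -
  obtain m where "m \<in> Poly_Mapping.keys f" "\<forall>t\<in>Poly_Mapping.keys f. le t m"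
    using monomial_order_finite_max[OF le, of "Poly_Mapping.keys f"] assms(2) by auto
  moreover from this have "lead_monom le f = m"
    by (intro lead_monom_eqI[OF le]) auto
  ultimately show "lead_monom le f \<in> Poly_Mapping.keys f"
    and "t \<in> Poly_Mapping.keys f \<Longrightarrow> le t (lead_monom le f)" by auto
qed

lemma lead_term_single:
  assumes "monomial_order le"
  shows "lead_term le (Poly_Mapping.single m 1) = Poly_Mapping.single m (1 :: 'k::field)"
proof -
  have "lead_monom le (Poly_Mapping.single m (1 :: 'k)) = m"
    using monomial_orderD[OF assms] by (intro lead_monom_eqI[OF assms]) auto
  then show ?thesis by (simp add: lead_term_def)
qed

lemma lead_term_eq_singleD:
  fixes f :: "('v, 'k::field) mpoly"
  assumes le: "monomial_order le" and f: "lead_term le f = Poly_Mapping.single m 1"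
    and t: "t \<in> Poly_Mapping.keys f"
  shows "le t m"
proof -
  from f have "Poly_Mapping.keys (lead_term le f) = {m}" by simp
  then have "lead_monom le f = m"
    by (simp add: lead_term_def split: if_splits)
  moreover from t have "f \<noteq> 0" by auto
  ultimately show ?thesis using lead_monom_max(2)[OF le _ t] by auto
qed

section \<open>Membership of monomials in ideals\<close>

lemma module_times: "module ((*) :: 'a::comm_ring_1 \<Rightarrow> 'a \<Rightarrow> 'a)"
  by unfold_locales (auto simp: algebra_simps)

lemma single_in_ideal_span:
  assumes "Poly_Mapping.single t 1 \<in> B"
    and "\<And>v. Poly_Mapping.lookup t v \<le> Poly_Mapping.lookup m v"
  shows "Poly_Mapping.single m (c :: 'k::field) \<in> ideal_span B"
proof -
  have "Poly_Mapping.single m c = Poly_Mapping.single (m - t) c * Poly_Mapping.single t 1"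
    using monom_le_imp_diff_add[of t m] assms(2) by (simp add: mult_single)
  then show ?thesis
    using assms(1) module.span_scale[OF module_times] module.span_base[OF module_times] by metis
qed

section \<open>Contraction of the generic determinant\<close>

text \<open>Turns annihilation into linear equations, one for each \<open>\<gamma>\<close>: a pair
  of monomials contributes at \<open>\<gamma>\<close> exactly when the second is the first
  multiplied by \<open>\<gamma>\<close>.\<close>

lemma lookup_contract:
  fixes \<Phi> F :: "('v, 'k::comm_ring_1) mpoly"
  shows "Poly_Mapping.lookup (contract \<Phi> F) \<gamma> =
     (\<Sum>\<alpha>\<in>Poly_Mapping.keys \<Phi>. Poly_Mapping.lookup \<Phi> \<alpha> * Poly_Mapping.lookup F (\<alpha> + \<gamma>))"
proof -
  have term_eq: "Poly_Mapping.lookup (Poly_Mapping.single 0 c * contract_monom \<alpha> \<beta>) \<gamma> =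
      (if \<beta> = \<alpha> + \<gamma> then c else 0)" for c :: 'k and \<alpha> \<beta>
  proof (cases "\<forall>v. Poly_Mapping.lookup \<alpha> v \<le> Poly_Mapping.lookup \<beta> v")
    case True
    then have "\<beta> - \<alpha> + \<alpha> = \<beta>" by (intro monom_le_imp_diff_add) auto
    then have "\<beta> - \<alpha> = \<gamma> \<longleftrightarrow> \<beta> = \<alpha> + \<gamma>" by (metis add.commute add_diff_cancel_left')
    with True show ?thesis
      by (simp add: contract_monom_def mult_single lookup_single when_def)
  next
    case False
    then show ?thesis by (auto simp: contract_monom_def lookup_add)
  qed
  show ?thesis
    unfolding contract_def lookup_sum term_eq
    by (auto intro!: sum.cong simp: in_keys_iff)
qed

section \<open>Perfect matchings and their monomials\<close>

definition graph_monom :: "('n::finite \<Rightarrow> 'n) \<Rightarrow> ('n \<times> 'n) monom" where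
  "graph_monom p = (\<Sum>i\<in>UNIV. unit_monom (i, p i))"

lemma lookup_graph_monom:
  "Poly_Mapping.lookup (graph_monom p) (i, j) = (if p i = j then 1 else 0)"
proof -
  have "Poly_Mapping.lookup (graph_monom p) (i, j) = (\<Sum>k\<in>UNIV. if k = i then if p i = j then 1 else 0 else 0)"
    unfolding graph_monom_def lookup_sum by (intro sum.cong) (auto simp: lookup_single when_def)
  then show ?thesis by simp
qed

lemma graph_monom_inject: "graph_monom p = graph_monom q \<longleftrightarrow> p = q"
proof
  assume "graph_monom p = graph_monom q"
  then have "Poly_Mapping.lookup (graph_monom p) (i, p i) = Poly_Mapping.lookup (graph_monom q) (i, p i)" for i
    by simp
  then have "q i = p i" for i by (metis lookup_graph_monom zero_neq_one)
  then show "p = q" by auto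
qed simp

lemma prod_generic:
  fixes r c :: "'i \<Rightarrow> 'n::finite"
  assumes "finite A"
  shows "(\<Prod>i\<in>A. generic $ r i $ c i) =
    (Poly_Mapping.single (\<Sum>i\<in>A. unit_monom (r i, c i)) 1 :: ('n \<times> 'n, 'k::comm_ring_1) mpoly)"
  using assms by induction (simp_all add: generic_def var_def mult_single)

lemma lookup_of_int_times:
  "Poly_Mapping.lookup (of_int z * (f :: ('v, 'k::comm_ring_1) mpoly)) t = of_int z * Poly_Mapping.lookup f t"
proof -
  have nat: "Poly_Mapping.lookup (of_nat n * f) t = of_nat n * Poly_Mapping.lookup f t" for n
    by (induction n) (simp_all add: algebra_simps lookup_add)
  show ?thesis
    by (cases z rule: int_diff_cases) (simp add: left_diff_distrib lookup_minus nat)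
qed

lemma lookup_det_generic:
  "Poly_Mapping.lookup (det (generic :: (_, 'k::comm_ring_1) mpoly ^ 'n::finite ^ 'n)) t =
     (\<Sum>p | p permutes UNIV. if graph_monom p = t then of_int (sign p) else 0)"
  unfolding det_def lookup_sum
  by (intro sum.cong) (auto simp: prod_generic lookup_of_int_times lookup_single when_def
      simp flip: graph_monom_def)

text \<open>Distinct permutations have distinct monomials, so a single summand survives.\<close>

lemma lookup_det_graph_monom:
  assumes "p permutes UNIV"
  shows "Poly_Mapping.lookup (det (generic :: (_, 'k::comm_ring_1) mpoly ^ 'n::finite ^ 'n)) (graph_monom p) =
     of_int (sign p)"
  unfolding lookup_det_generic graph_monom_inject using assms by simp

lemma lookup_det_nonzeroE:
  assumes "Poly_Mapping.lookup (det (generic :: (_, 'k::comm_ring_1) mpoly ^ 'n::finite ^ 'n)) t \<noteq> 0"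
  obtains p where "p permutes UNIV" "t = graph_monom p"
proof -
  have "\<exists>p. p permutes UNIV \<and> graph_monom p = t"
  proof (rule ccontr)
    assume "\<not> ?thesis"
    then have "\<And>p. p permutes UNIV \<Longrightarrow> graph_monom p \<noteq> t" by blast
    with assms show False unfolding lookup_det_generic by simp
  qed
  then show ?thesis using that by blast
qed

text \<open>A row meets the graph of \<open>p\<close> in one cell, so the two unit factors determine
  \<open>p i\<close> and \<open>p k\<close>, and \<open>\<gamma>\<close> is the graph over the other
  rows. Composing with the transposition changes only the rows \<open>i\<close> and
  \<open>k\<close>.\<close>

lemma graph_monom_transpose:
  assumes ik: "i \<noteq> k" and eq: "graph_monom p = unit_monom (i, j) + unit_monom (k, l) + \<gamma>"
  shows "p i = j" "p k = l"
    and "graph_monom (p \<circ> Transposition.transpose i k) = unit_monom (i, l) + unit_monom (k, j) + \<gamma>"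
proof -
  have ge: "Poly_Mapping.lookup (graph_monom p) v \<ge> Poly_Mapping.lookup (unit_monom (i, j) + unit_monom (k, l)) v" for v
    unfolding eq by (simp add: lookup_add)
  show pi: "p i = j" and pk: "p k = l"
    using ge[of "(i, j)"] ge[of "(k, l)"]
    by (auto simp: lookup_graph_monom lookup_add lookup_single split: if_splits)
  have split: "graph_monom q = unit_monom (i, q i) + unit_monom (k, q k) + (\<Sum>a\<in>UNIV - {i} - {k}. unit_monom (a, q a))" for q
    using ik by (simp add: graph_monom_def sum.remove[of UNIV i] sum.remove[of "UNIV - {i}" k] add.assoc)
  have "\<gamma> = (\<Sum>a\<in>UNIV - {i} - {k}. unit_monom (a, p a))"
    using eq split[of p] pi pk by simp
  also have "\<dots> = (\<Sum>a\<in>UNIV - {i} - {k}. unit_monom (a, (p \<circ> Transposition.transpose i k) a))"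
    by (intro sum.cong) (auto simp: Transposition.transpose_def)
  finally show "graph_monom (p \<circ> Transposition.transpose i k) = unit_monom (i, l) + unit_monom (k, j) + \<gamma>"
    using split[of "p \<circ> Transposition.transpose i k"] pi pk by simp
qed

lemma permutes_UNIV_transpose:
  assumes "p permutes (UNIV :: 'n::finite set)" "i \<noteq> k"
  shows "p \<circ> Transposition.transpose i k permutes UNIV"
    and "sign (p \<circ> Transposition.transpose i k) = - sign p"
proof -
  have "permutation p" using assms(1) by (rule permutes_imp_permutation[OF finite])
  then show "sign (p \<circ> Transposition.transpose i k) = - sign p"
    using assms(2) by (simp add: sign_compose permutation_swap_id sign_swap_id)
qed (rule permutes_compose[OF permutes_swap_id[OF UNIV_I UNIV_I] assms(1)])

text \<open>Exchanging the columns of two cells in distinct rows composes the matching with a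
  transposition and so flips its sign. If neither monomial is a perfect matching, both coefficients
  are 0.\<close>

lemma lookup_det_swap:
  fixes \<gamma> :: "('n::finite \<times> 'n) monom"
  defines "d \<equiv> det (generic :: (_, 'k::comm_ring_1) mpoly ^ 'n ^ 'n)"
  assumes "i \<noteq> k"
  shows "Poly_Mapping.lookup d (unit_monom (i, j) + unit_monom (k, l) + \<gamma>) =
    - Poly_Mapping.lookup d (unit_monom (i, l) + unit_monom (k, j) + \<gamma>)"
proof -
  \<comment> \<open>Stated for arbitrary \<open>j\<close> and \<open>l\<close>, so that it applies
    from whichever side has a nonzero coefficient.\<close>
  have swap: "Poly_Mapping.lookup d (unit_monom (i, j) + unit_monom (k, l) + \<gamma>) =
    - Poly_Mapping.lookup d (unit_monom (i, l) + unit_monom (k, j) + \<gamma>)"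
    if "Poly_Mapping.lookup d (unit_monom (i, j) + unit_monom (k, l) + \<gamma>) \<noteq> 0" for j l
  proof -
    from that obtain p where p: "p permutes UNIV"
      "unit_monom (i, j) + unit_monom (k, l) + \<gamma> = graph_monom p"
      unfolding d_def by (rule lookup_det_nonzeroE)
    note q = permutes_UNIV_transpose[OF p(1) assms(2)]
    show ?thesis
      unfolding d_def p(2) graph_monom_transpose(3)[OF assms(2) p(2)[symmetric], symmetric]
      by (simp add: lookup_det_graph_monom[OF p(1)] lookup_det_graph_monom[OF q(1)] q(2))
  qed
  show ?thesis
    using swap[of j l] swap[of l j] by (metis minus_zero)
qed

text \<open>Divisors of a perfect matching are partial matchings: distinct cells of a graph lie in
  distinct rows, and injectivity separates the columns. The converse is
  \<open>acceptable_extends_to_permutation\<close>.\<close>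

lemma acceptable_if_le_graph_monom:
  assumes "p permutes UNIV" "\<And>v. Poly_Mapping.lookup m v \<le> Poly_Mapping.lookup (graph_monom p) v"
  shows "acceptable m"
proof -
  have le1: "Poly_Mapping.lookup m (i, j) \<le> (if p i = j then 1 else 0)" for i j
    using assms(2)[of "(i, j)"] by (simp add: lookup_graph_monom)
  then have "Poly_Mapping.lookup m v \<le> 1" for v
    using le1[of "fst v" "snd v"] by (simp split: if_splits)
  moreover have "p i = j" if "(i, j) \<in> Poly_Mapping.keys m" for i j
    using le1[of i j] that by (auto simp: in_keys_iff split: if_splits)
  ultimately show ?thesis
    using permutes_inj[OF assms(1)] unfolding acceptable_def by (metis injD prod.collapse)
qed

text \<open>A multiple of \<open>m\<close> occurring in the determinant would be a perfect matching,
  making its divisor \<open>m\<close> acceptable. Hence every coefficient of the contraction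
  vanishes.\<close>

lemma unacceptable_in_Ann_det:
  assumes "\<not> acceptable m"
  shows "Poly_Mapping.single m 1 \<in> Ann (det (generic :: (_, 'k::comm_ring_1) mpoly ^ 'n::finite ^ 'n))"
proof -
  have "Poly_Mapping.lookup (det (generic :: (_, 'k) mpoly ^ 'n ^ 'n)) (m + \<gamma>) = 0" for \<gamma>
  proof (rule ccontr)
    assume "Poly_Mapping.lookup (det (generic :: (_, 'k) mpoly ^ 'n ^ 'n)) (m + \<gamma>) \<noteq> 0"
    then obtain p where p: "p permutes UNIV" "m + \<gamma> = graph_monom p"
      by (rule lookup_det_nonzeroE)
    have "Poly_Mapping.lookup m v \<le> Poly_Mapping.lookup (graph_monom p) v" for v
      by (simp flip: p(2) add: lookup_add)
    with p(1) assms show False using acceptable_if_le_graph_monom by blast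
  qed
  then show ?thesis
    by (auto simp: Ann_def lookup_contract intro!: poly_mapping_eqI sum.neutral)
qed

lemma generic_subpermanent:
  "generic $ i $ j * generic $ k $ l + generic $ i $ l * generic $ k $ j =
     (Poly_Mapping.single (unit_monom (i, j) + unit_monom (k, l)) 1 +
      Poly_Mapping.single (unit_monom (i, l) + unit_monom (k, j)) 1 :: (_, 'k::comm_ring_1) mpoly)"
  by (simp add: generic_def var_def mult_single)

lemma diagonal_neq_antidiagonal:
  assumes "i \<noteq> k" "j \<noteq> l"
  shows "unit_monom (i, j) + unit_monom (k, l) \<noteq> unit_monom (i, l) + unit_monom (k, j)"
proof
  assume "unit_monom (i, j) + unit_monom (k, l) = unit_monom (i, l) + unit_monom (k, j)"
  then have "Poly_Mapping.lookup (unit_monom (i, j) + unit_monom (k, l)) (i, j) =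
      Poly_Mapping.lookup (unit_monom (i, l) + unit_monom (k, j)) (i, j)" by simp
  with assms show False by (simp add: lookup_add lookup_single)
qed

lemma keys_add_two_singles:
  assumes "s \<noteq> t"
  shows "Poly_Mapping.keys (Poly_Mapping.single s 1 + Poly_Mapping.single t (1 :: 'k::field)) = {s, t}"
  using assms by (auto simp: in_keys_iff lookup_add lookup_single when_def split: if_splits)

text \<open>Each coefficient of the contraction is a sum of two determinant coefficients, which are
  opposite by \<open>lookup_det_swap\<close>.\<close>

lemma subpermanent_in_Ann_det:
  assumes "i \<noteq> k" "j \<noteq> l"
  shows "generic $ i $ j * generic $ k $ l + generic $ i $ l * generic $ k $ j
    \<in> Ann (det (generic :: (_, 'k::field) mpoly ^ 'n::finite ^ 'n))"
  unfolding Ann_def mem_Collect_eq generic_subpermanent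
  using diagonal_neq_antidiagonal[OF assms] lookup_det_swap[OF assms(1), of j l, where 'k = 'k]
  by (intro poly_mapping_eqI)
    (simp add: lookup_contract keys_add_two_singles lookup_add lookup_single)

section \<open>Antidiagonal matchings under a diagonal order\<close>

lemma permutes_lessThan_two: "{p. p permutes {..<2::nat}} = {id, Transposition.transpose 0 1}"
proof -
  have "{..<2::nat} = {0, 1}" by auto
  then show ?thesis by (simp only: permutes_doubleton_iff) auto
qed

text \<open>The antidiagonal monomial occurs in the 2 by 2 permanent with coefficient 1 and in the
  determinant with coefficient -1, so under either alternative of \<open>diagonal_order\<close> it
  is bounded by the leading diagonal.\<close>

lemma diagonal_orderD:
  fixes le :: "('n::{finite, linorder} \<times> 'n) monom \<Rightarrow> ('n \<times> 'n) monom \<Rightarrow> bool"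
  assumes d: "diagonal_order TYPE('k::field) le" and "i < k" "j < l"
  shows "le (unit_monom (i, l) + unit_monom (k, j)) (unit_monom (i, j) + unit_monom (k, l))"
proof -
  \<comment> \<open>The arguments 0 and 1 enumerate the chosen rows and columns in increasing
    order.\<close>
  define r c where "r n = (if n = 0 then i else k)" and "c n = (if n = 0 then j else l)" for n :: nat
  let ?d = "unit_monom (i, j) + unit_monom (k, l)" and ?a = "unit_monom (i, l) + unit_monom (k, j)"
  let ?\<tau> = "Transposition.transpose 0 (1::nat)"
  have le: "monomial_order le" using d by (simp add: diagonal_order_def)
  have mono: "strict_mono_on {..<2} r" "strict_mono_on {..<2} c"
    using assms(2,3) by (auto simp: strict_mono_on_def r_def c_def)
  have two: "{..<2::nat} = {0, 1}" by auto
  have ne: "?d \<noteq> ?a" using assms(2,3) by (intro diagonal_neq_antidiagonal) auto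
  have id_ne: "id \<noteq> ?\<tau>" by (metis id_apply transpose_apply_first zero_neq_one)
  have pd: "(\<Prod>n<2. generic $ r n $ c n) = (Poly_Mapping.single ?d 1 :: (_, 'k) mpoly)"
    by (simp add: two generic_def var_def mult_single r_def c_def)
  have pa: "(\<Prod>n<2. generic $ r n $ c (?\<tau> n)) = (Poly_Mapping.single ?a 1 :: (_, 'k) mpoly)"
    by (simp add: two generic_def var_def mult_single r_def c_def)
  have "lead_term le (sub_perm 2 r c) = (Poly_Mapping.single ?d 1 :: (_, 'k) mpoly)
      \<or> lead_term le (sub_det 2 r c) = (Poly_Mapping.single ?d 1 :: (_, 'k) mpoly)"
    using d mono unfolding diagonal_order_def Let_def pd[symmetric] by blast
  moreover have "?a \<in> Poly_Mapping.keys (sub_perm 2 r c :: (_, 'k) mpoly)"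
    using ne id_ne by (simp add: sub_perm_def permutes_lessThan_two pd pa in_keys_iff lookup_add lookup_single)
  moreover have "?a \<in> Poly_Mapping.keys (sub_det 2 r c :: (_, 'k) mpoly)"
    using ne id_ne
    by (simp add: sub_det_def permutes_lessThan_two pd pa in_keys_iff lookup_add lookup_minus lookup_single
        sign_swap_id)
  ultimately show ?thesis using lead_term_eq_singleD[OF le] by blast
qed

lemma lead_term_subpermanent:
  fixes le :: "('n::{finite, linorder} \<times> 'n) monom \<Rightarrow> ('n \<times> 'n) monom \<Rightarrow> bool"
  assumes d: "diagonal_order TYPE('k::field) le" and ij: "i < k" "j < l"
  shows "lead_term le (generic $ i $ j * generic $ k $ l + generic $ i $ l * generic $ k $ j) =
    (Poly_Mapping.single (unit_monom (i, j) + unit_monom (k, l)) 1 :: (_, 'k) mpoly)"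
proof -
  let ?d = "unit_monom (i, j) + unit_monom (k, l)" and ?a = "unit_monom (i, l) + unit_monom (k, j)"
  let ?f = "Poly_Mapping.single ?d 1 + Poly_Mapping.single ?a (1 :: 'k)"
  have le: "monomial_order le" using d by (simp add: diagonal_order_def)
  have ne: "?d \<noteq> ?a" using ij by (intro diagonal_neq_antidiagonal) auto
  have "lead_monom le ?f = ?d"
    using diagonal_orderD[OF d ij] monomial_orderD(1)[OF le]
    by (intro lead_monom_eqI[OF le]) (auto simp: keys_add_two_singles[OF ne])
  with ne show ?thesis
    by (simp add: generic_subpermanent lead_term_def lookup_add lookup_single)
qed

text \<open>At the least index where the maps differ, each value is attained by the other map at
  that index or later, so neither value exceeds the other.\<close>

lemma strict_antimono_on_unique:
  fixes p q :: "'a::{finite, linorder} \<Rightarrow> 'b::linorder"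
  assumes p: "strict_antimono_on I p" and q: "strict_antimono_on I q" and "p ` I = q ` I" "i \<in> I"
  shows "p i = q i"
proof (rule ccontr)
  assume "p i \<noteq> q i"
  define m where "m = Min {k \<in> I. p k \<noteq> q k}"
  have "m \<in> {k \<in> I. p k \<noteq> q k}"
    unfolding m_def using \<open>i \<in> I\<close> \<open>p i \<noteq> q i\<close> by (intro Min_in) auto
  then have m: "m \<in> I" "p m \<noteq> q m" by auto
  have least: "p k = q k" if "k \<in> I" "k < m" for k
    using that Min_le[of "{k \<in> I. p k \<noteq> q k}" k] unfolding m_def by (auto simp flip: not_le)
  have *: "g m \<le> f m" if "f ` I = g ` I" "strict_antimono_on I f" "strict_antimono_on I g"
    "\<And>k. k < m \<Longrightarrow> k \<in> I \<Longrightarrow> f k = g k" for f g :: "'a \<Rightarrow> 'b"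
  proof -
    have "g m \<in> f ` I" using that(1) m(1) by simp
    then obtain k where k: "k \<in> I" "g m = f k" by blast
    \<comment> \<open>For \<open>k < m\<close> the choice of \<open>m\<close> gives
      \<open>g k = f k = g m\<close>, against strict descent of \<open>g\<close>.\<close>
    have "\<not> k < m"
      using monotone_onD[OF that(3) k(1) m(1)] that(4)[OF _ k(1)] k(2) by auto
    then have "m < k \<or> m = k" by auto
    then show ?thesis
      using monotone_onD[OF that(2) m(1) k(1)] k(2) by auto
  qed
  have "p m = q m"
    using *[OF assms(3) p q] *[OF assms(3)[symmetric] q p] least by (intro order_antisym) auto
  with m(2) show False ..
qed

text \<open>Extremal argument: a least matching among those agreeing with \<open>p\<close> off
  \<open>I\<close> has no increasing pair in \<open>I\<close>, since exchanging the columns of such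
  a pair would give a different matching that is no larger. So it is decreasing on \<open>I\<close>,
  and by uniqueness of decreasing matchings it is \<open>p\<close>.\<close>

lemma antidiagonal_matching_least:
  fixes le :: "('n::{finite, linorder} \<times> 'n) monom \<Rightarrow> ('n \<times> 'n) monom \<Rightarrow> bool"
  assumes d: "diagonal_order TYPE('k::field) le"
    and p: "p permutes UNIV" and anti: "strict_antimono_on I p"
    and q: "q permutes UNIV" and off: "\<And>i. i \<notin> I \<Longrightarrow> q i = p i"
  shows "le (graph_monom p) (graph_monom q)"
proof -
  have le: "monomial_order le" using d by (simp add: diagonal_order_def)
  define Q where "Q = {q. q permutes UNIV \<and> (\<forall>i. i \<notin> I \<longrightarrow> q i = p i)}"
  have "finite (graph_monom ` Q)" by simp
  moreover have "q \<in> Q" using q off by (simp add: Q_def)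
  ultimately obtain s where s: "s \<in> Q" and min: "\<And>t. t \<in> Q \<Longrightarrow> le (graph_monom s) (graph_monom t)"
    using monomial_order_finite_min[OF le, of "graph_monom ` Q"] by auto
  have bij: "bij s" "bij p" using s p by (auto simp: Q_def intro: permutes_bij)
  have santi: "strict_antimono_on I s"
  proof (rule monotone_onI, rule ccontr)
    fix i k assume ik: "i \<in> I" "k \<in> I" "i < k" "\<not> s k < s i"
    then have lt: "s i < s k" using bij(1) by (metis bij_pointE less_irrefl linorder_neqE)
    let ?t = "s \<circ> Transposition.transpose i k"
    obtain \<gamma> where \<gamma>: "graph_monom s = unit_monom (i, s i) + unit_monom (k, s k) + \<gamma>"
      using ik(3) by (simp add: graph_monom_def sum.remove[of UNIV i] sum.remove[of "UNIV - {i}" k]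
          flip: add.assoc)
    have t: "graph_monom ?t = unit_monom (i, s k) + unit_monom (k, s i) + \<gamma>"
      using graph_monom_transpose(3)[OF _ \<gamma>] ik(3) by auto
    \<comment> \<open>Both exchanged rows lie in \<open>I\<close>, so agreement with
      \<open>p\<close> off \<open>I\<close> survives.\<close>
    have "?t \<in> Q"
      using s permutes_UNIV_transpose(1)[of s i k] ik by (auto simp: Q_def Transposition.transpose_def)
    then have "le (graph_monom s) (graph_monom ?t)" by (rule min)
    moreover have "le (graph_monom ?t) (graph_monom s)"
      unfolding t \<gamma> by (intro monomial_orderD(5)[OF le] diagonal_orderD[OF d ik(3) lt])
    ultimately have "s = ?t" using monomial_orderD(2)[OF le] graph_monom_inject by blast
    then have "s i = s k" by (metis comp_apply transpose_apply_first)
    with lt show False by simp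
  qed
  \<comment> \<open>Bijections with the same image on the complement of \<open>I\<close> have the
    same image on \<open>I\<close>, as the uniqueness lemma requires.\<close>
  have "s ` (- I) = p ` (- I)" using s by (intro image_cong) (auto simp: Q_def)
  then have "s ` I = p ` I" using bij by (metis bij_image_Compl_eq compl_eq_compl_iff)
  then have "s = p"
    using strict_antimono_on_unique[OF santi anti] s by (auto simp: Q_def)
  with min[OF \<open>q \<in> Q\<close>] show ?thesis by simp
qed

text \<open>The cells of \<open>m\<close> form the graph of a bijection between its rows and its
  columns. The remaining rows and columns are equally many, so any bijection between them completes
  it.\<close>

lemma acceptable_extends_to_permutation:
  fixes m :: "('n::finite \<times> 'n) monom"
  assumes "acceptable m"
  obtains p where "p permutes UNIV" "\<And>v. Poly_Mapping.lookup m v \<le> Poly_Mapping.lookup (graph_monom p) v"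
proof -
  let ?K = "Poly_Mapping.keys m"
  have inj: "inj_on fst ?K" "inj_on snd ?K"
    using assms by (auto simp: acceptable_def inj_on_def)
  \<comment> \<open>\<open>g\<close> sends each row occurring in \<open>m\<close> to the column of
    its unique cell.\<close>
  define g where "g = snd \<circ> inv_into ?K fst"
  have g: "g i = j" if "(i, j) \<in> ?K" for i j
    using inv_into_f_f[OF inj(1) that] by (simp add: g_def)
  have bg: "bij_betw g (fst ` ?K) (snd ` ?K)"
    unfolding g_def using inj by (intro bij_betw_trans[OF bij_betw_inv_into]) (auto simp: bij_betw_def)
  then have "card (- (fst ` ?K)) = card (- (snd ` ?K))"
    by (simp add: Compl_eq_Diff_UNIV card_Diff_subset bij_betw_same_card)
  then obtain h where bh: "bij_betw h (- (fst ` ?K)) (- (snd ` ?K))"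
    using finite_same_card_bij by (metis finite_code)
  define p where "p i = (if i \<in> fst ` ?K then g i else h i)" for i
  have "bij_betw p (fst ` ?K \<union> - (fst ` ?K)) (snd ` ?K \<union> - (snd ` ?K))"
    unfolding p_def using bg bh by (rule bij_betw_disjoint_Un) auto
  then have "p permutes UNIV" by (intro bij_imp_permutes) auto
  moreover have "Poly_Mapping.lookup m v \<le> Poly_Mapping.lookup (graph_monom p) v" for v
  proof (cases "v \<in> ?K")
    case True
    obtain i j where v: "v = (i, j)" by (cases v)
    with True g have "p i = j" by (force simp: p_def)
    with v assms show ?thesis by (simp add: lookup_graph_monom acceptable_def)
  qed (simp add: in_keys_iff)
  ultimately show ?thesis by (rule that)
qed

text \<open>The two cells form the diagonal of a 2 by 2 submatrix, so the leading monomial of a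
  subpermanent divides that of \<open>f\<close>. Without such a pair the leading monomial is a
  decreasing matching, and a single coefficient of the contraction yields the contradiction.\<close>

lemma lead_monom_Ann_det_not_antidiagonal:
  fixes le :: "('n::{finite, linorder} \<times> 'n) monom \<Rightarrow> ('n \<times> 'n) monom \<Rightarrow> bool"
  assumes d: "diagonal_order TYPE('k::field) le"
    and f: "f \<in> Ann (det (generic :: (_, 'k) mpoly ^ 'n::{finite, linorder} ^ 'n::{finite, linorder}))" "f \<noteq> 0"
    and acc: "acceptable (lead_monom le f)"
  shows "\<exists>i j k l. i < k \<and> j < l \<and>
    (i, j) \<in> Poly_Mapping.keys (lead_monom le f) \<and> (k, l) \<in> Poly_Mapping.keys (lead_monom le f)"
proof (rule ccontr)
  let ?m = "lead_monom le f" and ?det = "det (generic :: (_, 'k) mpoly ^ 'n::{finite, linorder} ^ 'n::{finite, linorder})"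
  assume *: "\<not> ?thesis"
  have le: "monomial_order le" using d by (simp add: diagonal_order_def)
  note max = lead_monom_max[OF le f(2)]
  obtain p where p: "p permutes UNIV" "\<And>v. Poly_Mapping.lookup ?m v \<le> Poly_Mapping.lookup (graph_monom p) v"
    using acceptable_extends_to_permutation[OF acc] by blast
  \<comment> \<open>The part of the perfect matching \<open>p\<close> outside the leading monomial;
    the contraction is examined at this one coefficient.\<close>
  define \<gamma> where "\<gamma> = graph_monom p - ?m"
  have m\<gamma>: "?m + \<gamma> = graph_monom p"
    using monom_le_imp_diff_add[of ?m, OF p(2)] by (simp add: \<gamma>_def add.commute)
  define I where "I = fst ` Poly_Mapping.keys ?m"
  have key: "p i = j" if "(i, j) \<in> Poly_Mapping.keys ?m" for i j
    using p(2)[of "(i, j)"] that by (auto simp: lookup_graph_monom in_keys_iff split: if_splits)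
  have "strict_antimono_on I p"
  proof (rule monotone_onI)
    fix i k assume ik: "i \<in> I" "k \<in> I" "i < k"
    then have "(i, p i) \<in> Poly_Mapping.keys ?m" "(k, p k) \<in> Poly_Mapping.keys ?m"
      using key by (auto simp: I_def)
    with * ik(3) have "\<not> p i < p k" by blast
    moreover have "p i \<noteq> p k" using ik(3) permutes_inj[OF p(1)] by (auto dest: injD)
    ultimately show "p k < p i" by auto
  qed
  note least = antidiagonal_matching_least[OF d p(1) this]
  \<comment> \<open>A surviving \<open>\<alpha>\<close> would complete with \<open>\<gamma>\<close>
    to a matching \<open>q\<close>. It is at least \<open>p\<close> by leastness and at most
    \<open>p\<close> because \<open>\<alpha>\<close> is bounded by the leading monomial, so
    \<open>\<alpha>\<close> would be the leading monomial.\<close>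
  have zero: "Poly_Mapping.lookup ?det (\<alpha> + \<gamma>) = 0"
    if \<alpha>: "\<alpha> \<in> Poly_Mapping.keys f" "\<alpha> \<noteq> ?m" for \<alpha>
  proof (rule ccontr)
    assume "Poly_Mapping.lookup ?det (\<alpha> + \<gamma>) \<noteq> 0"
    then obtain q where q: "q permutes UNIV" "\<alpha> + \<gamma> = graph_monom q"
      by (rule lookup_det_nonzeroE)
    \<comment> \<open>For a row outside \<open>I\<close> the cell of \<open>p\<close> belongs to
      \<open>\<gamma>\<close>, which divides the matching of \<open>q\<close>.\<close>
    have "q i = p i" if "i \<notin> I" for i
    proof -
      from that have "Poly_Mapping.lookup ?m (i, p i) = 0"
        by (force simp: I_def in_keys_iff)
      then have "Poly_Mapping.lookup \<gamma> (i, p i) = 1"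
        by (simp add: \<gamma>_def lookup_minus lookup_graph_monom)
      then have "Poly_Mapping.lookup (graph_monom q) (i, p i) \<noteq> 0"
        by (simp flip: q(2) add: lookup_add)
      then show ?thesis by (simp add: lookup_graph_monom split: if_splits)
    qed
    with q(1) have "le (graph_monom p) (graph_monom q)" by (rule least)
    moreover have "le (graph_monom q) (graph_monom p)"
      unfolding q(2)[symmetric] m\<gamma>[symmetric] by (intro monomial_orderD(5)[OF le] max(2) \<alpha>(1))
    ultimately have "graph_monom q = graph_monom p" using monomial_orderD(2)[OF le] by blast
    then show False using \<alpha>(2) q(2) m\<gamma> by (metis add_right_cancel)
  qed
  \<comment> \<open>What remains is the leading coefficient times the sign of \<open>p\<close>, both
    nonzero in the field.\<close>
  have "0 = Poly_Mapping.lookup (contract f ?det) \<gamma>"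
    using f(1) by (simp add: Ann_def)
  also have "\<dots> = Poly_Mapping.lookup f ?m * Poly_Mapping.lookup ?det (?m + \<gamma>)"
    unfolding lookup_contract
    by (subst sum.remove[OF _ max(1)]) (simp_all add: zero)
  also have "\<dots> = Poly_Mapping.lookup f ?m * of_int (sign p)"
    by (simp add: m\<gamma> lookup_det_graph_monom[OF p(1)])
  finally show False
    using max(1) by (auto simp: in_keys_iff sign_def split: if_splits)
qed

section \<open>The Groebner basis\<close>

text \<open>Acceptability fails through a repeated variable or through two variables in a common row
  or column; the square or the product is the quadric.\<close>

lemma unacceptable_divisible_by_quadric:
  assumes "\<not> acceptable m"
  obtains t where "\<not> acceptable t" "monom_degree t = 2"
    "\<And>v. Poly_Mapping.lookup t v \<le> Poly_Mapping.lookup m v"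
proof -
  consider v where "Poly_Mapping.lookup m v \<ge> 2"
    | v w where "v \<in> Poly_Mapping.keys m" "w \<in> Poly_Mapping.keys m" "v \<noteq> w" "fst v = fst w \<or> snd v = snd w"
    using assms unfolding acceptable_def by (metis not_less_eq_eq numeral_2_eq_2 One_nat_def)
  then show ?thesis
  proof cases
    case 1
    show ?thesis
    proof (rule that[of "unit_monom v + unit_monom v"])
      show "\<not> acceptable (unit_monom v + unit_monom v)"
      proof
        assume "acceptable (unit_monom v + unit_monom v)"
        then have "Poly_Mapping.lookup (unit_monom v + unit_monom v) v \<le> 1"
          unfolding acceptable_def by blast
        then show False by (simp add: lookup_add)
      qed
    qed (use 1 in \<open>auto simp: lookup_add lookup_single when_def\<close>)
  next
    case 2
    show ?thesis
    proof (rule that[of "unit_monom v + unit_monom w"])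
      have "v \<in> Poly_Mapping.keys (unit_monom v + unit_monom w)"
        "w \<in> Poly_Mapping.keys (unit_monom v + unit_monom w)"
        by (auto simp: in_keys_iff lookup_add)
      with 2 show "\<not> acceptable (unit_monom v + unit_monom w)"
        by (auto simp: acceptable_def)
    qed (use 2 in \<open>auto simp: lookup_add lookup_single when_def in_keys_iff\<close>)
  qed
qed

theorem theorem5p3:
  fixes le :: "('n::{finite, linorder} \<times> 'n) monom \<Rightarrow> ('n \<times> 'n) monom \<Rightarrow> bool"
  assumes "CHAR('k::field) = 0 \<or> CHAR('k) > 2"
    and "diagonal_order TYPE('k) le"
  shows "groebner_basis le
           (Ann (det (generic :: (_, 'k) mpoly ^ 'n::{finite, linorder} ^ 'n::{finite, linorder})))
           (unacceptable_quadrics \<union> subpermanents2)"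
proof -
  let ?I = "Ann (det (generic :: (_, 'k) mpoly ^ 'n::{finite, linorder} ^ 'n::{finite, linorder}))"
  let ?G = "unacceptable_quadrics \<union> subpermanents2 :: ('n \<times> 'n, 'k) mpoly set"
  note d = assms(2)
  have le: "monomial_order le" using d by (simp add: diagonal_order_def)
  have "unacceptable_quadrics \<subseteq>
      (\<lambda>m. Poly_Mapping.single m (1 :: 'k)) ` {m :: ('n \<times> 'n) monom. monom_degree m = 2}"
    by (auto simp: unacceptable_quadrics_def)
  then have "finite (unacceptable_quadrics :: ('n \<times> 'n, 'k) mpoly set)"
    by (rule finite_subset) (simp add: finite_monom_degree)
  moreover have "subpermanents2 \<subseteq> (\<lambda>(i, j, k, l). generic $ i $ j * generic $ k $ l
      + generic $ i $ l * generic $ k $ j :: ('n \<times> 'n, 'k) mpoly) ` UNIV"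
  proof
    fix f :: "('n \<times> 'n, 'k) mpoly"
    assume "f \<in> subpermanents2"
    then obtain i j k l where "f = generic $ i $ j * generic $ k $ l + generic $ i $ l * generic $ k $ j"
      by (auto simp: subpermanents2_def)
    then show "f \<in> (\<lambda>(i, j, k, l). generic $ i $ j * generic $ k $ l
        + generic $ i $ l * generic $ k $ j) ` UNIV"
      by (intro image_eqI[of _ _ "(i, j, k, l)"]) auto
  qed
  then have "finite (subpermanents2 :: ('n \<times> 'n, 'k) mpoly set)"
    by (rule finite_subset) simp
  ultimately have fin: "finite ?G" by simp
  \<comment> \<open>The two monomials of a subpermanent differ, so their coefficients cannot
    cancel.\<close>
  have "f \<noteq> 0" if "f \<in> subpermanents2" for f :: "('n \<times> 'n, 'k) mpoly"
  proof -
    from that obtain i j k l where "i < k" "j < l"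
      and f: "f = generic $ i $ j * generic $ k $ l + generic $ i $ l * generic $ k $ j"
      by (auto simp: subpermanents2_def)
    then have "unit_monom (i, j) + unit_monom (k, l) \<noteq> unit_monom (i, l) + unit_monom (k, j)"
      by (intro diagonal_neq_antidiagonal) auto
    from keys_add_two_singles[OF this, where 'k = 'k] show ?thesis
      unfolding f generic_subpermanent by (metis insert_not_empty keys_zero)
  qed
  then have nonzero: "0 \<notin> ?G"
    by (auto simp: unacceptable_quadrics_def) (metis single_zero keys_single keys_zero insert_not_empty zero_neq_one)
  have sub: "?G \<subseteq> ?I"
    by (auto simp: unacceptable_quadrics_def subpermanents2_def
        intro!: unacceptable_in_Ann_det subpermanent_in_Ann_det)
  \<comment> \<open>Membership reduces to divisibility by the leading monomial of one basis element:
    a subpermanent if the leading monomial of \<open>f\<close> is acceptable, an unacceptable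
    quadric otherwise.\<close>
  have "lead_term le f \<in> ideal_span (lead_term le ` ?G)" if f: "f \<in> ?I" "f \<noteq> 0" for f
  proof (cases "acceptable (lead_monom le f)")
    case True
    then obtain i j k l where ij: "i < k" "j < l" "(i, j) \<in> Poly_Mapping.keys (lead_monom le f)"
      "(k, l) \<in> Poly_Mapping.keys (lead_monom le f)"
      using lead_monom_Ann_det_not_antidiagonal[OF d f] by blast
    have "generic $ i $ j * generic $ k $ l + generic $ i $ l * generic $ k $ j \<in> ?G"
      using ij(1,2) by (auto simp: subpermanents2_def)
    then have "Poly_Mapping.single (unit_monom (i, j) + unit_monom (k, l)) 1 \<in> lead_term le ` ?G"
      by (rule image_eqI[rotated]) (simp add: lead_term_subpermanent[OF d ij(1,2)])
    then show ?thesis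
      unfolding lead_term_def[of le f]
      by (rule single_in_ideal_span)
        (use ij in \<open>auto simp: lookup_add lookup_single when_def in_keys_iff\<close>)
  next
    case False
    then obtain t where t: "\<not> acceptable t" "monom_degree t = 2"
      "\<And>v. Poly_Mapping.lookup t v \<le> Poly_Mapping.lookup (lead_monom le f) v"
      using unacceptable_divisible_by_quadric by blast
    have "Poly_Mapping.single t 1 \<in> ?G" using t by (auto simp: unacceptable_quadrics_def)
    then have "Poly_Mapping.single t 1 \<in> lead_term le ` ?G"
      by (rule image_eqI[rotated]) (simp add: lead_term_single[OF le])
    then show ?thesis
      unfolding lead_term_def[of le f] using t(3) by (rule single_in_ideal_span)
  qed
  then have "ideal_span (lead_term le ` (?I - {0})) \<subseteq> ideal_span (lead_term le ` ?G)"
    by (intro module.span_minimal[OF module_times] module.subspace_span[OF module_times]) auto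
  moreover have "ideal_span (lead_term le ` ?G) \<subseteq> ideal_span (lead_term le ` (?I - {0}))"
    using sub nonzero by (intro module.span_mono[OF module_times]) auto
  ultimately show ?thesis
    using fin nonzero sub by (auto simp: groebner_basis_def)
qed

end
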